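(* Let $\varphi,\psi,f$ be three linear fractional self-maps of the unit disk $\mathbb{D}$. Assume that both $\varphi$ and $\psi$ are different from the identity and denote by $p$ and $q$ their respective Denjoy-Wolff points. (1) If $\varphi$ is elliptic, then $f\circ\varphi=\psi\circ f$ if and only if $f(\mathrm{Fix}(\varphi))=\mathrm{Fix}(\psi)$ and $\varphi'(p)=\psi'(q)$. (2) If $\varphi$ is hyperbolic, then $f\circ\varphi=\psi\circ f$ if and only if $f(\mathrm{Fix}(\varphi))=\mathrm{Fix}(\psi)$, $f(p)=q$, and $\varphi'(p)=\psi'(q)$. (3) If $\varphi$ is parabolic, then $f\circ\varphi=\psi\circ f$ if and only if $f(\mathrm{Fix}(\varphi))=\mathrm{Fix}(\psi)$ and $f'(p)\,\psi''(q)=\varphi''(p)$.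
   Context: $\mathbb{D}$ is the open unit disk in $\mathbb{C}$ and $\widehat{\mathbb{C}}=\mathbb{C}\cup\{\infty\}$. A linear fractional self-map of $\mathbb{D}$ is a map of the form $h(z)=(az+b)/(cz+d)$, $ad-bc\ne0$, that is analytic in $\mathbb{D}$ with $h(\mathbb{D})\subset\mathbb{D}$; it is holomorphic in a neighborhood of $\overline{\mathbb{D}}$ and is also viewed as a bijection of $\widehat{\mathbb{C}}$. $\mathrm{Fix}(h)=\{w\in\widehat{\mathbb{C}}:h(w)=w\}$. Denjoy-Wolff point of a non-identity analytic self-map $g$ of $\mathbb{D}$: if $g$ has a fixed point in $\mathbb{D}$ (necessarily unique), it is that point (also when $g$ is an automorphism), and $g$ is called elliptic; otherwise it is the unique point $p\in\partial\mathbb{D}$ to which the iterates of $g$ converge uniformly on compact subsets of $\mathbb{D}$, and then $g$ is called hyperbolic if $g'(p)<1$ and parabolic if $g'(p)=1$ (always $0<g'(p)\le1$). *)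

theory Defs
  imports "HOL-Analysis.Analysis"
begin

text \<open>The extended complex plane: \<^term>\<open>None\<close> is the point at infinity, as in
  \<^const>\<open>Alexandroff_compactification\<close>.\<close>

type_synonym ext_complex = "complex option"

abbreviation unit_disk :: "complex set" where
  "unit_disk \<equiv> ball 0 1"

definition moebius_ext ::
  "complex \<Rightarrow> complex \<Rightarrow> complex \<Rightarrow> complex \<Rightarrow> ext_complex \<Rightarrow> ext_complex" where
  "moebius_ext a b c d w =
     (case w of
        None \<Rightarrow> (if c = 0 then None else Some (a / c))
      | Some z \<Rightarrow> (if c * z + d = 0 then None else Some (moebius a b c d z)))"

text \<open>The map read as a function on the finite plane; its value at a pole is unspecified. For a
  linear fractional self-map of the disk there is no pole in a neighbourhood of the closed disk,
  so \<^const>\<open>deriv\<close> of this function is the true derivative at every point of the closed disk.\<close>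

definition finite_part :: "(ext_complex \<Rightarrow> ext_complex) \<Rightarrow> complex \<Rightarrow> complex" where
  "finite_part h z = the (h (Some z))"

definition lin_frac_selfmap :: "(ext_complex \<Rightarrow> ext_complex) \<Rightarrow> bool" where
  "lin_frac_selfmap h \<longleftrightarrow>
     (\<exists>a b c d. a * d - b * c \<noteq> 0 \<and> h = moebius_ext a b c d) \<and>
     finite_part h holomorphic_on unit_disk \<and>
     h ` Some ` unit_disk \<subseteq> Some ` unit_disk"

definition Fix :: "(ext_complex \<Rightarrow> ext_complex) \<Rightarrow> ext_complex set" where
  "Fix h = {w. h w = w}"

text \<open>The following notions are meant for non-identity analytic self-maps of the disk.\<close>

definition elliptic :: "(complex \<Rightarrow> complex) \<Rightarrow> bool" where
  "elliptic g \<longleftrightarrow> (\<exists>z\<in>unit_disk. g z = z)"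

definition denjoy_wolff_point :: "(complex \<Rightarrow> complex) \<Rightarrow> complex \<Rightarrow> bool" where
  "denjoy_wolff_point g p \<longleftrightarrow>
     (if elliptic g then p \<in> unit_disk \<and> g p = p
      else p \<in> sphere 0 1 \<and>
        (\<forall>K. compact K \<and> K \<subseteq> unit_disk \<longrightarrow>
             uniform_limit K (\<lambda>n. g ^^ n) (\<lambda>_. p) sequentially))"

text \<open>Here \<^const>\<open>deriv\<close> at the boundary point stands for the derivative of a function that is
  holomorphic near the closed disk. The order on the complex numbers is
  \<open>x < y \<longleftrightarrow> Re x < Re y \<and> Im x = Im y\<close>, so the inequality says that the derivative is real and
  less than 1.\<close>

definition hyperbolic :: "(complex \<Rightarrow> complex) \<Rightarrow> bool" where
  "hyperbolic g \<longleftrightarrow> \<not> elliptic g \<and> (\<exists>p. denjoy_wolff_point g p \<and> deriv g p < 1)"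

definition parabolic :: "(complex \<Rightarrow> complex) \<Rightarrow> bool" where
  "parabolic g \<longleftrightarrow> \<not> elliptic g \<and> (\<exists>p. denjoy_wolff_point g p \<and> deriv g p = 1)"

text \<open>The equation $f \circ \varphi = \psi \circ f$ between self-maps of the disk.\<close>

definition intertwines ::
  "(ext_complex \<Rightarrow> ext_complex) \<Rightarrow> (ext_complex \<Rightarrow> ext_complex) \<Rightarrow>
   (ext_complex \<Rightarrow> ext_complex) \<Rightarrow> bool" where
  "intertwines f \<phi> \<psi> \<longleftrightarrow> (\<forall>z\<in>unit_disk. (f \<circ> \<phi>) (Some z) = (\<psi> \<circ> f) (Some z))"

end

theory Submission
  imports Defs "HOL-Complex_Analysis.Riemann_Mapping"
begin

text \<open>
  A Moebius map that takes a finite point \<open>p\<close> to a finite point \<open>q\<close> can be written uniquely as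
  \<open>z \<mapsto> q + l (z - p) / (1 + c (z - p))\<close> with \<open>l \<noteq> 0\<close>. Here \<open>l\<close> is the derivative at \<open>p\<close> and
  \<open>- 2 l c\<close> the second derivative, and composing maps with parameters \<open>(l, c)\<close> and then \<open>(m, e)\<close> gives
  \<open>(l m, c + e l)\<close>. Suppose that \<open>f(p) = q\<close>, and give \<open>\<phi>\<close>, \<open>\<psi>\<close> and \<open>f\<close> the parameters \<open>(l, c)\<close>,
  \<open>(l', c')\<close> and \<open>(m, e)\<close> at \<open>p\<close>, \<open>q\<close> and \<open>p\<close>. Then \<open>f \<circ> \<phi> = \<psi> \<circ> f\<close> holds on the sphere exactly when
  \<open>l = l'\<close> and \<open>c + e l = e + c' m\<close>. The first equation is \<open>\<phi>'(p) = \<psi>'(q)\<close>. For \<open>l \<noteq> 1\<close> the map \<open>\<phi>\<close> has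
  a second fixed point \<open>p + (l - 1) / c\<close> (infinity for \<open>c = 0\<close>), and the second equation says that \<open>f\<close> takes it to the
  second fixed point of \<open>\<psi>\<close>; for \<open>l = 1\<close> it says \<open>c = c' m\<close>, that is, \<open>\<phi>''(p) = f'(p) \<psi>''(q)\<close>. This
  is \<open>commute_iff_at_fixpoints\<close>, and \<open>intertwines_iff_commute\<close> connects it with the intertwining relation on
  the disk.
  
  It remains to see in each case that \<open>f(p) = q\<close> and whether the multiplier is 1. If \<open>\<phi>\<close> is
  elliptic, the Schwarz lemma, transported to \<open>p\<close> (\<open>Schwarz_Pick_fixpoint\<close>), gives \<open>\<phi>'(p) \<noteq> 1\<close>, and it shows
  that \<open>\<psi>\<close> has at most one fixed point in the disk; both sides of the equivalence make \<open>f(p)\<close> such a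
  point. If \<open>\<phi>\<close> is parabolic, \<open>p\<close> is its only fixed point, and \<open>f(p) = q\<close> follows from the equality
  of the fixed point sets. If \<open>\<phi>\<close> is hyperbolic, there are two fixed points on the sphere, and algebra cannot tell
  which of them goes to \<open>q\<close>; this is why \<open>f(p) = q\<close> is part of the criterion. That it follows from
  commutation is a dynamical fact (\<open>commute_maps_denjoy_wolff\<close>): \<open>f\<close> carries orbits of \<open>\<phi>\<close> to orbits
  of \<open>\<psi>\<close>, hence limits to limits.
\<close>

section \<open>Normal form of a Moebius map at a point\<close>

lemma moebius_ext_scale:
  assumes "k \<noteq> 0"
  shows "moebius_ext (k * a) (k * b) (k * c) (k * d) = moebius_ext a b c d"
proof
  fix w
  have "k * c * z + k * d = k * (c * z + d)" "k * a * z + k * b = k * (a * z + b)" for z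
    by (simp_all add: algebra_simps)
  then show "moebius_ext (k * a) (k * b) (k * c) (k * d) w = moebius_ext a b c d w"
    using assms by (auto simp: moebius_ext_def moebius_def split: option.split)
qed

lemma moebius_ext_comp:
  assumes "a * d - b * c \<noteq> 0" and "a' * d' - b' * c' \<noteq> 0"
  shows "moebius_ext a b c d \<circ> moebius_ext a' b' c' d' =
    moebius_ext (a * a' + b * c') (a * b' + b * d') (c * a' + d * c') (c * b' + d * d')"
proof
  fix w
  have inf: "c' \<noteq> 0 \<or> a' \<noteq> 0" "c \<noteq> 0 \<or> a \<noteq> 0"
    using assms by auto
  \<comment> \<open>At a pole of the inner map the outer map is evaluated at infinity; numerator and denominator
    cannot both vanish there.\<close>
  have num: "a' * z + b' \<noteq> 0" if "c' * z + d' = 0" for z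
  proof
    assume "a' * z + b' = 0"
    moreover have "a' * d' - b' * c' = a' * (c' * z + d') - c' * (a' * z + b')"
      by (simp add: algebra_simps)
    ultimately show False using assms(2) that by simp
  qed
  show "(moebius_ext a b c d \<circ> moebius_ext a' b' c' d') w =
    moebius_ext (a * a' + b * c') (a * b' + b * d') (c * a' + d * c') (c * b' + d * d') w"
  proof (cases w)
    case None
    show ?thesis
    proof (cases "c' = 0")
      case True
      with inf show ?thesis by (auto simp: None moebius_ext_def moebius_def)
    next
      case False
      then have "c * (a' / c') + d = (c * a' + d * c') / c'" "a * (a' / c') + b = (a * a' + b * c') / c'"
        by (simp_all add: field_simps)
      with False show ?thesis by (auto simp: None moebius_ext_def moebius_def)
    qed
  next
    case (Some z)
    have e1: "(c * a' + d * c') * z + (c * b' + d * d') = c * (a' * z + b') + d * (c' * z + d')"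
      and e2: "(a * a' + b * c') * z + (a * b' + b * d') = a * (a' * z + b') + b * (c' * z + d')"
      by (simp_all add: algebra_simps)
    show ?thesis
    proof (cases "c' * z + d' = 0")
      case True
      with num[OF True] show ?thesis by (auto simp: Some moebius_ext_def moebius_def e1 e2)
    next
      case False
      have frac: "u * (N / D) + v = (u * N + v * D) / D" if "D \<noteq> 0" for u v N D :: complex
        using that by (simp add: field_simps)
      from False show ?thesis
        by (auto simp: Some moebius_ext_def moebius_def e1 e2 frac simp del: times_divide_eq_right)
    qed
  qed
qed

text \<open>
  The map \<open>z \<mapsto> q + l (z - p) / (1 + c (z - p))\<close>, extended to infinity. Every Moebius map that takes the
  finite point \<open>p\<close> to the finite point \<open>q\<close> has this form with \<open>l \<noteq> 0\<close>. The parameters are its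
  jet at \<open>p\<close>: the first derivative there is \<open>l\<close> and the second is \<open>- 2 l c\<close>.
\<close>

definition moebius_at ::
  "complex \<Rightarrow> complex \<Rightarrow> complex \<Rightarrow> complex \<Rightarrow> ext_complex \<Rightarrow> ext_complex" where
  "moebius_at p q l c = moebius_ext (l + q * c) (q * (1 - c * p) - l * p) c (1 - c * p)"

lemma moebius_at_det:
  "(l + q * c) * (1 - c * p) - (q * (1 - c * p) - l * p) * c = (l :: complex)"
  by (simp add: algebra_simps)

lemma moebius_at_Some:
  "moebius_at p q l c (Some z) =
     (if 1 + c * (z - p) = 0 then None else Some (q + l * (z - p) / (1 + c * (z - p))))"
proof -
  have den: "c * z + (1 - c * p) = 1 + c * (z - p)"
    and num: "(l + q * c) * z + (q * (1 - c * p) - l * p) = q * (1 + c * (z - p)) + l * (z - p)"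
    by (simp_all add: algebra_simps)
  then show ?thesis
    unfolding moebius_at_def moebius_ext_def moebius_def option.case den num
    by (simp add: add_divide_distrib)
qed

lemma moebius_at_None:
  "moebius_at p q l c None = (if c = 0 then None else Some (q + l / c))"
  by (simp add: moebius_at_def moebius_ext_def field_simps)

text \<open>
  Divide the matrix by \<open>c p + d\<close>, so that the denominator takes the value 1 at \<open>p\<close>; then
  \<open>l\<close> is the determinant of the scaled matrix.
\<close>

lemma moebius_ext_eq_moebius_at:
  assumes det: "a * d - b * c \<noteq> 0" and val: "moebius_ext a b c d (Some p) = Some q"
  obtains l e where "l \<noteq> 0" "moebius_ext a b c d = moebius_at p q l e"
proof -
  define D where "D = c * p + d"
  have D: "D \<noteq> 0" and q: "q = (a * p + b) / D"
    using val by (auto simp: moebius_ext_def moebius_def D_def split: if_splits)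
  define l e where "l = (a * d - b * c) / D\<^sup>2" and "e = c / D"
  have d: "d = D - c * p" and b: "b = q * D - a * p"
    using D by (simp_all add: D_def q)
  have c: "c = D * e" using D by (simp add: e_def)
  have l: "D * l = a - q * c"
    using D unfolding l_def by (simp add: d b field_simps power2_eq_square)
  have "D * (l + q * e) = a" by (simp add: algebra_simps l c)
  moreover have "D * (q * (1 - e * p) - l * p) = b"
  proof -
    have "D * (q * (1 - e * p) - l * p) = q * D - q * (D * e) * p - (D * l) * p"
      by (simp add: algebra_simps)
    also have "\<dots> = b" unfolding l b c by (simp add: algebra_simps)
    finally show ?thesis .
  qed
  moreover have "D * (1 - e * p) = d" by (simp add: algebra_simps c d)
  ultimately have "moebius_ext a b c d = moebius_at p q l e"
    using moebius_ext_scale[OF D, of "l + q * e" "q * (1 - e * p) - l * p" e "1 - e * p"]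
    by (simp add: moebius_at_def c)
  moreover have "l \<noteq> 0" using det D by (simp add: l_def)
  ultimately show thesis using that by blast
qed

text \<open>
  The second parameter is additive up to the twist by \<open>l\<close>, as it must be for the coefficient of a
  second derivative. This is why commutation relations turn into equations between parameters.
\<close>

lemma moebius_at_comp:
  assumes "l \<noteq> 0" "m \<noteq> 0"
  shows "moebius_at q r m e \<circ> moebius_at p q l c = moebius_at p r (l * m) (c + e * l)"
proof -
  have "moebius_at q r m e \<circ> moebius_at p q l c =
    moebius_ext ((m + r * e) * (l + q * c) + (r * (1 - e * q) - m * q) * c)
      ((m + r * e) * (q * (1 - c * p) - l * p) + (r * (1 - e * q) - m * q) * (1 - c * p))
      (e * (l + q * c) + (1 - e * q) * c)
      (e * (q * (1 - c * p) - l * p) + (1 - e * q) * (1 - c * p))"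
    unfolding moebius_at_def
    using assms by (intro moebius_ext_comp) (simp_all only: moebius_at_det not_False_eq_True)
  also have "\<dots> = moebius_at p r (l * m) (c + e * l)"
    unfolding moebius_at_def by (intro arg_cong4[where f = moebius_ext]) (simp_all add: algebra_simps)
  finally show ?thesis .
qed


lemma moebius_at_id: "moebius_at p p 1 0 = id"
proof
  show "moebius_at p p 1 0 w = id w" for w
    by (cases w) (simp_all add: moebius_at_None moebius_at_Some)
qed

lemma bij_moebius_at:
  assumes "l \<noteq> 0"
  shows "bij (moebius_at p q l c)"
proof (rule o_bij)
  show "moebius_at q p (1 / l) (- c / l) \<circ> moebius_at p q l c = id"
    and "moebius_at p q l c \<circ> moebius_at q p (1 / l) (- c / l) = id"
    using assms by (simp_all add: moebius_at_comp moebius_at_id)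
qed

lemma eventually_no_pole:
  fixes c p :: complex
  shows "\<forall>\<^sub>F z in nhds p. 1 + c * (z - p) \<noteq> 0"
proof -
  have "((\<lambda>z. 1 + c * (z - p)) \<longlongrightarrow> 1 + c * (p - p)) (nhds p)"
    by (intro tendsto_intros filterlim_ident)
  then show ?thesis
    by (rule tendsto_imp_eventually_ne) simp
qed

lemma has_field_derivative_moebius_at:
  assumes "1 + c * (z - p) \<noteq> 0"
  shows "(finite_part (moebius_at p q l c) has_field_derivative l / (1 + c * (z - p))\<^sup>2) (at z)"
proof -
  have "((\<lambda>z. q + l * (z - p) / (1 + c * (z - p))) has_field_derivative l / (1 + c * (z - p))\<^sup>2) (at z)"
    using assms by (auto intro!: derivative_eq_intros simp: power2_eq_square field_simps)
  moreover have "open {z. 1 + c * (z - p) \<noteq> 0}"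
    by (intro open_Collect_neq continuous_intros)
  ultimately show ?thesis
    by (rule has_field_derivative_transform_within_open)
      (use assms in \<open>auto simp: finite_part_def moebius_at_Some\<close>)
qed

lemma deriv_moebius_at: "deriv (finite_part (moebius_at p q l c)) p = l"
  using DERIV_imp_deriv[OF has_field_derivative_moebius_at[of c p p q l]] by simp

lemma deriv2_moebius_at: "(deriv ^^ 2) (finite_part (moebius_at p q l c)) p = - 2 * l * c"
proof -
  let ?F = "finite_part (moebius_at p q l c)"
  have ev: "\<forall>\<^sub>F z in nhds p. deriv ?F z = l / (1 + c * (z - p))\<^sup>2"
    using eventually_no_pole
    by eventually_elim (rule DERIV_imp_deriv[OF has_field_derivative_moebius_at])
  have "((\<lambda>z. l / (1 + c * (z - p))\<^sup>2) has_field_derivative - 2 * l * c) (at p)"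
    by (auto intro!: derivative_eq_intros simp: power2_eq_square)
  then have "deriv (\<lambda>z. l / (1 + c * (z - p))\<^sup>2) p = - 2 * l * c"
    by (rule DERIV_imp_deriv)
  with deriv_cong_ev[OF ev refl] show ?thesis by (simp add: numeral_2_eq_2)
qed

text \<open>
  The parameters can be read off from the derivatives at the base point, so they are determined by the
  map near that point.
\<close>

lemma moebius_at_eqD:
  assumes "l \<noteq> 0"
    and "\<forall>\<^sub>F z in nhds p. moebius_at p q l c (Some z) = moebius_at p q' l' c' (Some z)"
  shows "l = l' \<and> c = c'"
proof -
  have ev: "\<forall>\<^sub>F z in nhds p.
      finite_part (moebius_at p q l c) z = finite_part (moebius_at p q' l' c') z"
    using assms(2) by eventually_elim (simp add: finite_part_def)
  have "l = l'"
    using deriv_cong_ev[OF ev refl] by (simp add: deriv_moebius_at)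
  moreover have "- 2 * l * c = - 2 * l' * c'"
    using higher_deriv_cong_ev[OF ev refl, of 2] by (simp only: deriv2_moebius_at)
  ultimately show ?thesis using assms(1) by simp
qed

section \<open>Fixed points and commutation in normal form\<close>

text \<open>
  The fixed point of \<open>moebius_at p p l c\<close> other than \<open>p\<close>. It coincides with \<open>p\<close> when \<open>l = 1\<close> and
  \<open>c \<noteq> 0\<close>, which is the case of a double fixed point.
\<close>

definition second_fixpoint :: "complex \<Rightarrow> complex \<Rightarrow> complex \<Rightarrow> ext_complex" where
  "second_fixpoint p l c = (if c = 0 then None else Some (p + (l - 1) / c))"

lemma Fix_moebius_at:
  assumes "l \<noteq> 0" and "moebius_at p p l c \<noteq> id"
  shows "Fix (moebius_at p p l c) = {Some p, second_fixpoint p l c}"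
proof -
  have triv: "l \<noteq> 1 \<or> c \<noteq> 0"
    using assms(2) by (auto simp: moebius_at_id)
  have "moebius_at p p l c (Some z) = Some z \<longleftrightarrow> z = p \<or> c \<noteq> 0 \<and> z = p + (l - 1) / c" for z
  proof (cases "1 + c * (z - p) = 0")
    case True
    moreover have "z \<noteq> p" using True by auto
    moreover have "z \<noteq> p + (l - 1) / c" if "c \<noteq> 0"
    proof
      assume "z = p + (l - 1) / c"
      then have "1 + c * (z - p) = l" using that by simp
      then show False using True assms(1) by simp
    qed
    ultimately show ?thesis by (auto simp: moebius_at_Some)
  next
    case False
    have "p + l * (z - p) / (1 + c * (z - p)) = z \<longleftrightarrow> l * (z - p) / (1 + c * (z - p)) = z - p"
      by (auto simp: algebra_simps)
    also have "\<dots> \<longleftrightarrow> l * (z - p) = (z - p) * (1 + c * (z - p))"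
      using False by (simp add: divide_eq_eq)
    also have "\<dots> \<longleftrightarrow> (z - p) * (c * (z - p) - (l - 1)) = 0"
      by (auto simp: algebra_simps)
    also have "\<dots> \<longleftrightarrow> z = p \<or> c * (z - p) = l - 1"
      by auto
    also have "\<dots> \<longleftrightarrow> z = p \<or> c \<noteq> 0 \<and> z = p + (l - 1) / c"
      using triv by (cases "c = 0") (auto simp: field_simps)
    finally show ?thesis using False by (simp add: moebius_at_Some)
  qed
  moreover have "moebius_at p p l c None = None \<longleftrightarrow> c = 0"
    by (simp add: moebius_at_None)
  ultimately have "moebius_at p p l c w = w \<longleftrightarrow> w = Some p \<or> w = second_fixpoint p l c" for w
    by (cases w) (auto simp: second_fixpoint_def)
  then show ?thesis by (auto simp: Fix_def)
qed

lemma second_fixpoint_eq_iff: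
  assumes "l \<noteq> 0" and "moebius_at p p l c \<noteq> id"
  shows "second_fixpoint p l c = Some p \<longleftrightarrow> l = 1"
  using assms by (auto simp: second_fixpoint_def moebius_at_id)

text \<open>
  For multiplier different from 1, the condition on the second-order parameters that remains in
  \<open>f \<circ> \<phi> = \<psi> \<circ> f\<close> once the multipliers agree is the condition that \<open>f\<close> maps the second fixed point
  to the second fixed point. The computation covers fixed points at infinity too.
\<close>

lemma second_fixpoint_map_iff:
  assumes "l \<noteq> 1" "m \<noteq> 0"
  shows "moebius_at p q m e (second_fixpoint p l c) = second_fixpoint q l c' \<longleftrightarrow>
    c + e * l = e + c' * m"
proof -
  have eq: "c + e * l = e + c' * m \<longleftrightarrow> c' * m = c + e * (l - 1)"
    by (auto simp: algebra_simps)
  have c': "second_fixpoint q l c' = Some (q + m * (l - 1) / d) \<longleftrightarrow> c' * m = d" if "d \<noteq> 0" for d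
  proof (cases "c' = 0")
    case False
    have "(l - 1) / c' = m * (l - 1) / d \<longleftrightarrow> (l - 1) * (c' * m - d) = 0"
      using False that by (auto simp: frac_eq_eq algebra_simps)
    with False assms show ?thesis by (simp add: second_fixpoint_def)
  qed (use that in \<open>simp add: second_fixpoint_def\<close>)
  have c0: "second_fixpoint q l c' = None \<longleftrightarrow> c' * m = 0"
    using assms by (simp add: second_fixpoint_def)
  have val: "moebius_at p q m e (second_fixpoint p l c) =
    (if c + e * (l - 1) = 0 then None else Some (q + m * (l - 1) / (c + e * (l - 1))))"
  proof (cases "c = 0")
    case True
    then show ?thesis using assms by (simp add: second_fixpoint_def moebius_at_None)
  next
    case False
    then have "1 + e * ((l - 1) / c) = (c + e * (l - 1)) / c"
      by (simp add: field_simps)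
    with False show ?thesis by (simp add: second_fixpoint_def moebius_at_Some)
  qed
  show ?thesis
    unfolding eq val using c0 c'[of "c + e * (l - 1)"] by metis
qed

lemma commute_moebius_at_iff:
  assumes "l \<noteq> 0" "m \<noteq> 0" "l' \<noteq> 0"
  shows "moebius_at p q m e \<circ> moebius_at p p l c = moebius_at q q l' c' \<circ> moebius_at p q m e \<longleftrightarrow>
    l = l' \<and> c + e * l = e + c' * m"
proof -
  have "moebius_at p q (l * m) (c + e * l) = moebius_at p q (m * l') (e + c' * m) \<longleftrightarrow>
    l * m = m * l' \<and> c + e * l = e + c' * m"
    using moebius_at_eqD[of "l * m" p q "c + e * l" q "m * l'" "e + c' * m"] assms
    by (auto simp: mult.commute)
  with assms show ?thesis by (simp add: moebius_at_comp)
qed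

lemma image_Fix_of_commute:
  assumes "bij f" and "f \<circ> \<phi> = \<psi> \<circ> f"
  shows "f ` Fix \<phi> = Fix \<psi>"
proof -
  have "f w \<in> Fix \<psi> \<longleftrightarrow> w \<in> Fix \<phi>" for w
    using assms by (auto simp: Fix_def fun_eq_iff bij_def inj_eq simp flip: assms(2)[THEN fun_cong, unfolded o_def])
  then show ?thesis
    using bij_is_surj[OF assms(1)] by (auto simp: image_iff) (metis surjD)
qed


section \<open>Linear fractional self-maps of the disk\<close>

lemma selfmap_disk:
  assumes "lin_frac_selfmap h" "norm z < 1"
  shows "h (Some z) = Some (finite_part h z)" "norm (finite_part h z) < 1"
proof -
  have "h (Some z) \<in> Some ` unit_disk"
    using assms unfolding lin_frac_selfmap_def by auto
  then show "h (Some z) = Some (finite_part h z)" "norm (finite_part h z) < 1"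
    by (auto simp: finite_part_def)
qed

text \<open>
  The inequality \<open>\<bar>a z + b\<bar> \<le> \<bar>c z + d\<bar>\<close> extends from the disk to its closure by continuity. A pole on
  the circle would therefore be a zero of the numerator as well, against the nonvanishing determinant.
\<close>

lemma selfmap_cdisk:
  assumes h: "lin_frac_selfmap h" and z: "norm z \<le> 1"
  shows "h (Some z) = Some (finite_part h z)" "norm (finite_part h z) \<le> 1"
proof -
  obtain a b c d where det: "a * d - b * c \<noteq> 0" and eq: "h = moebius_ext a b c d"
    using h unfolding lin_frac_selfmap_def by blast
  have disk: "norm (a * z + b) - norm (c * z + d) \<le> 0" if "z \<in> ball 0 1" for z
  proof -
    have "norm z < 1" using that by simp
    from selfmap_disk[OF h this] have "c * z + d \<noteq> 0" "norm ((a * z + b) / (c * z + d)) < 1"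
      by (auto simp: eq finite_part_def moebius_ext_def moebius_def split: if_splits)
    then show ?thesis by (simp add: norm_divide divide_less_eq)
  qed
  have le: "norm (a * z + b) - norm (c * z + d) \<le> 0"
    by (rule continuous_le_on_closure[where S = "ball 0 1"])
      (use z disk in \<open>auto intro!: continuous_intros\<close>)
  have den: "c * z + d \<noteq> 0"
  proof
    assume 0: "c * z + d = 0"
    with le have "a * z + b = 0" by simp
    moreover have "a * d - b * c = a * (c * z + d) - c * (a * z + b)"
      by (simp add: algebra_simps)
    ultimately have "a * d - b * c = 0" using 0 by simp
    then show False using det by simp
  qed
  then show "h (Some z) = Some (finite_part h z)" "norm (finite_part h z) \<le> 1"
    using le by (simp_all add: eq finite_part_def moebius_ext_def moebius_def norm_divide divide_le_eq)
qed

lemma selfmap_normal_form: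
  assumes h: "lin_frac_selfmap h" and p: "norm p \<le> 1" and q: "finite_part h p = q"
  obtains l c where "l \<noteq> 0" "h = moebius_at p q l c"
proof -
  obtain a b c d where det: "a * d - b * c \<noteq> 0" and eq: "h = moebius_ext a b c d"
    using h unfolding lin_frac_selfmap_def by blast
  have "moebius_ext a b c d (Some p) = Some q"
    using selfmap_cdisk(1)[OF h p] eq q by simp
  from moebius_ext_eq_moebius_at[OF det this] show thesis
    using that unfolding eq by blast
qed

lemma bij_selfmap:
  assumes "lin_frac_selfmap h"
  shows "bij h"
proof -
  obtain q l c where "l \<noteq> 0" "h = moebius_at 0 q l c"
    using selfmap_normal_form[OF assms _ refl, of 0] norm_zero zero_le_one by metis
  then show ?thesis by (simp add: bij_moebius_at)
qed

lemma isCont_finite_part_selfmap: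
  assumes h: "lin_frac_selfmap h" and p: "norm p \<le> 1"
  shows "isCont (finite_part h) p"
proof -
  obtain l c where h_eq: "h = moebius_at p (finite_part h p) l c"
    by (rule selfmap_normal_form[OF h p refl])
  have "1 + c * (p - p) \<noteq> 0" by simp
  from DERIV_isCont[OF has_field_derivative_moebius_at[OF this, of "finite_part h p" l]]
  show ?thesis unfolding h_eq[symmetric] .
qed

text \<open>
  An identity between Moebius maps propagates from the disk to the sphere: in normal form at the
  origin both composites have the same parameters. This allows fixed points outside the disk
  to be used.
\<close>

lemma intertwines_iff_commute:
  assumes \<phi>: "lin_frac_selfmap \<phi>" and \<psi>: "lin_frac_selfmap \<psi>" and f: "lin_frac_selfmap f"
  shows "intertwines f \<phi> \<psi> \<longleftrightarrow> f \<circ> \<phi> = \<psi> \<circ> f"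
proof
  assume int: "intertwines f \<phi> \<psi>"
  obtain r s t u where vals: "finite_part \<phi> 0 = r" "finite_part f 0 = s"
      "finite_part f r = t" "finite_part \<psi> s = u"
    by blast
  have norm_le: "norm (0::complex) \<le> 1" "norm r \<le> 1" "norm s \<le> 1"
    using selfmap_cdisk(2)[OF \<phi>, of 0] selfmap_cdisk(2)[OF f, of 0] by (simp_all add: vals)
  obtain m e where f0: "m \<noteq> 0" "f = moebius_at 0 s m e"
    using selfmap_normal_form[OF f norm_le(1) vals(2)] by blast
  obtain m' e' where fr: "m' \<noteq> 0" "f = moebius_at r t m' e'"
    using selfmap_normal_form[OF f norm_le(2) vals(3)] by blast
  obtain l c where \<phi>0: "l \<noteq> 0" "\<phi> = moebius_at 0 r l c"
    using selfmap_normal_form[OF \<phi> norm_le(1) vals(1)] by blast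
  obtain l' c' where \<psi>s: "l' \<noteq> 0" "\<psi> = moebius_at s u l' c'"
    using selfmap_normal_form[OF \<psi> norm_le(3) vals(4)] by blast
  have comps: "f \<circ> \<phi> = moebius_at 0 t (l * m') (c + e' * l)"
    "\<psi> \<circ> f = moebius_at 0 u (m * l') (e + c' * m)"
    using moebius_at_comp[OF \<phi>0(1) fr(1), of r t e' 0 c, folded \<phi>0(2) fr(2)]
      moebius_at_comp[OF f0(1) \<psi>s(1), of s u c' 0 e, folded f0(2) \<psi>s(2)] by blast+
  have "\<forall>\<^sub>F z in nhds 0. z \<in> unit_disk"
    by (intro eventually_nhds_in_open) auto
  then have "\<forall>\<^sub>F z in nhds 0. (f \<circ> \<phi>) (Some z) = (\<psi> \<circ> f) (Some z)"
    by eventually_elim (use int in \<open>simp add: intertwines_def\<close>)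
  then have params: "l * m' = m * l' \<and> c + e' * l = e + c' * m"
    unfolding comps by (intro moebius_at_eqD[where q = t and q' = u]) (simp_all add: \<phi>0(1) fr(1))
  have "(f \<circ> \<phi>) (Some 0) = (\<psi> \<circ> f) (Some 0)"
    using int by (simp add: intertwines_def)
  then have "t = u"
    unfolding comps by (simp add: moebius_at_Some)
  with params show "f \<circ> \<phi> = \<psi> \<circ> f" unfolding comps by simp
qed (simp add: intertwines_def)

section \<open>Self-maps with a fixed point in the disk\<close>

text \<open>
  Conjugating with the disk automorphism that moves \<open>p\<close> to the origin reduces both claims to the Schwarz
  lemma. In the equality case the conjugated map is a rotation, and a second fixed point or the
  derivative 1 forces the rotation to be trivial.
\<close>

lemma Schwarz_Pick_fixpoint:
  assumes holo: "h holomorphic_on ball 0 1" and maps: "\<And>z. norm z < 1 \<Longrightarrow> norm (h z) < 1"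
    and p: "norm p < 1" "h p = p"
  shows "norm z < 1 \<Longrightarrow> norm (Moebius_function 0 p (h z)) \<le> norm (Moebius_function 0 p z)"
    and "(\<exists>z. norm z < 1 \<and> z \<noteq> p \<and> h z = z) \<or> deriv h p = 1 \<Longrightarrow> norm w < 1 \<Longrightarrow> h w = w"
proof -
  define M where "M = Moebius_function 0 p"
  define N where "N = Moebius_function 0 (- p)"
  have NM: "N (M z) = z" and MN: "M (N z) = z" if "norm z < 1" for z
    using Moebius_function_compose[of "-p" p z] Moebius_function_compose[of p "-p" z] p that
    by (simp_all add: M_def N_def)
  have bM: "norm (M z) < 1" and bN: "norm (N z) < 1" if "norm z < 1" for z
    using Moebius_function_norm_lt_1[of p z] Moebius_function_norm_lt_1[of "-p" z] p that
    by (simp_all add: M_def N_def)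
  have holM: "M holomorphic_on ball 0 1" and holN: "N holomorphic_on ball 0 1"
    using Moebius_function_holomorphic p by (simp_all add: M_def N_def)
  have Mp: "M p = 0" and N0: "N 0 = p"
    by (simp_all add: M_def N_def Moebius_function_eq_zero Moebius_function_of_zero)
  define g where "g = M \<circ> h \<circ> N"
  have holg: "g holomorphic_on ball 0 1"
    unfolding g_def
    by (rule holomorphic_on_compose_gen[OF holN holomorphic_on_compose_gen[OF holo holM]])
      (auto simp: bN maps)
  have g0: "g 0 = 0" by (simp add: g_def N0 p Mp)
  have bg: "norm (g z) < 1" if "norm z < 1" for z
    using that by (simp add: g_def bM bN maps)
  have gM: "g (M z) = M (h z)" if "norm z < 1" for z
    using that by (simp add: g_def NM)
  show "norm (Moebius_function 0 p (h z)) \<le> norm (Moebius_function 0 p z)" if "norm z < 1" for z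
    using Schwarz_Lemma(1)[OF holg g0 bg bM[OF that]] gM[OF that] by (simp add: M_def)
  have diff: "F field_differentiable at z" if "F holomorphic_on ball 0 1" "norm z < 1" for F z
    using that by (intro holomorphic_on_imp_differentiable_at[of F "ball 0 1"]) auto
  have dMN: "deriv M p * deriv N 0 = 1"
  proof -
    have "\<forall>\<^sub>F z in nhds 0. z \<in> ball (0::complex) 1"
      by (intro eventually_nhds_in_open) auto
    then have "\<forall>\<^sub>F z in nhds 0. (M \<circ> N) z = z"
      by eventually_elim (simp add: MN)
    then have "deriv (M \<circ> N) 0 = deriv (\<lambda>z. z) 0"
      by (rule deriv_cong_ev) simp
    moreover have "deriv (M \<circ> N) 0 = deriv M (N 0) * deriv N 0"
      by (rule deriv_chain) (use diff holM holN N0 p in auto)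
    ultimately show ?thesis by (simp add: N0)
  qed
  have dg: "deriv g 0 = deriv h p"
  proof -
    have "deriv g 0 = deriv (M \<circ> h) (N 0) * deriv N 0"
      unfolding g_def by (rule deriv_chain)
        (use diff holM holN holo N0 p in \<open>auto intro!: field_differentiable_compose\<close>)
    also have "deriv (M \<circ> h) (N 0) = deriv M (h p) * deriv h p"
      unfolding N0 by (rule deriv_chain) (use diff holM holo p in auto)
    also have "\<dots> * deriv N 0 = deriv h p * (deriv M p * deriv N 0)"
      by (simp add: p)
    finally show ?thesis by (simp add: dMN)
  qed
  assume fixed: "(\<exists>z. norm z < 1 \<and> z \<noteq> p \<and> h z = z) \<or> deriv h p = 1" and w: "norm w < 1"
  have fixed_g: "(\<exists>z. norm z < 1 \<and> z \<noteq> 0 \<and> g z = z) \<or> deriv g 0 = 1"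
    using fixed
  proof
    assume "\<exists>z. norm z < 1 \<and> z \<noteq> p \<and> h z = z"
    then obtain z where z: "norm z < 1" "z \<noteq> p" "h z = z" by blast
    then have "M z \<noteq> 0" using NM[of z] N0 by auto
    moreover have "g (M z) = M z" using gM[OF z(1)] z(3) by simp
    ultimately show ?thesis using bM[OF z(1)] by blast
  qed (simp add: dg)
  then have "(\<exists>z. norm z < 1 \<and> z \<noteq> 0 \<and> norm (g z) = norm z) \<or> norm (deriv g 0) = 1"
    by force
  from Schwarz_Lemma(3)[OF holg g0 bg bM[OF w] this]
  obtain \<alpha> where \<alpha>: "\<And>z. norm z < 1 \<Longrightarrow> g z = \<alpha> * z" by blast
  have "\<alpha> = 1"
    using fixed_g
  proof
    assume "\<exists>z. norm z < 1 \<and> z \<noteq> 0 \<and> g z = z"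
    then obtain z where z: "norm z < 1" "z \<noteq> 0" "g z = z" by blast
    with \<alpha>[of z] show ?thesis by simp
  next
    assume 1: "deriv g 0 = 1"
    have "\<forall>\<^sub>F z in nhds 0. z \<in> ball (0::complex) 1"
      by (intro eventually_nhds_in_open) auto
    then have "\<forall>\<^sub>F z in nhds 0. g z = \<alpha> * z"
      by eventually_elim (simp add: \<alpha>)
    then have "deriv g 0 = deriv (\<lambda>z. \<alpha> * z) 0"
      by (rule deriv_cong_ev) simp
    then show ?thesis using 1 by simp
  qed
  then have "M (h w) = M w"
    using \<alpha>[OF bM[OF w]] gM[OF w] by simp
  then have "N (M (h w)) = N (M w)" by simp
  then show "h w = w" unfolding NM[OF w] NM[OF maps[OF w]] .
qed

text \<open>
  Otherwise the equality case of the Schwarz lemma makes the map the identity on the disk, hence on the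
  sphere.
\<close>

lemma selfmap_interior_fixpoint:
  assumes h: "lin_frac_selfmap h" and nid: "h \<noteq> id"
    and p: "norm p < 1" "finite_part h p = p"
  shows "deriv (finite_part h) p \<noteq> 1"
    and "norm z < 1 \<Longrightarrow> finite_part h z = z \<Longrightarrow> z = p"
proof -
  let ?H = "finite_part h"
  have holo: "?H holomorphic_on ball 0 1"
    using h by (simp add: lin_frac_selfmap_def)
  obtain l c where lc: "l \<noteq> 0" "h = moebius_at p p l c"
    using selfmap_normal_form[OF h less_imp_le[OF p(1)] p(2)] by blast
  have "\<exists>w. norm w < 1 \<and> ?H w \<noteq> w"
  proof (rule ccontr)
    assume "\<not> (\<exists>w. norm w < 1 \<and> ?H w \<noteq> w)"
    then have all: "h (Some w) = Some w" if "norm w < 1" for w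
      using selfmap_disk(1)[OF h that] that by simp
    have "\<forall>\<^sub>F z in nhds p. z \<in> ball 0 1"
      by (intro eventually_nhds_in_open) (use p in auto)
    then have "\<forall>\<^sub>F z in nhds p. moebius_at p p l c (Some z) = moebius_at p p 1 0 (Some z)"
      by eventually_elim (use all lc in \<open>simp add: moebius_at_id\<close>)
    from moebius_at_eqD[OF lc(1) this] show False
      using nid lc(2) by (simp add: moebius_at_id)
  qed
  then obtain w where w: "norm w < 1" "?H w \<noteq> w" by blast
  show "deriv ?H p \<noteq> 1"
    using Schwarz_Pick_fixpoint(2)[OF holo selfmap_disk(2)[OF h] p _ w(1)] w(2) by blast
  show "z = p" if "norm z < 1" "?H z = z"
    using Schwarz_Pick_fixpoint(2)[OF holo selfmap_disk(2)[OF h] p _ w(1)] w(2) that by blast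
qed

lemma norm_Moebius_function_boundary:
  assumes p: "norm p < 1" and z: "norm z = 1"
  shows "norm (Moebius_function 0 p z) = 1"
proof -
  have "1 - cnj p * z = cnj (z - p) * z"
    using z complex_norm_square[of z] by (simp add: algebra_simps)
  then have "norm (1 - cnj p * z) = norm (z - p)"
    using z by (simp only: norm_mult complex_mod_cnj)
  moreover have "z \<noteq> p" using p z by auto
  ultimately show ?thesis by (simp add: Moebius_function_simple norm_divide)
qed

text \<open>
  By Schwarz and Pick the orbit stays in a closed pseudo-hyperbolic disk about \<open>q\<close>, which is a compact
  subset of the open disk.
\<close>

lemma orbit_of_elliptic_not_to_boundary:
  assumes h: "lin_frac_selfmap h" and q: "norm q < 1" "finite_part h q = q"
    and z: "norm z < 1" and lim: "(\<lambda>n. (finite_part h ^^ n) z) \<longlonglongrightarrow> w"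
  shows "norm w \<noteq> 1"
proof
  assume w: "norm w = 1"
  let ?H = "finite_part h" and ?M = "Moebius_function 0 q"
  have orbit: "norm ((?H ^^ n) z) < 1 \<and> norm (?M ((?H ^^ n) z)) \<le> norm (?M z)" for n
  proof (induction n)
    case (Suc n)
    then have "norm (?M (?H ((?H ^^ n) z))) \<le> norm (?M ((?H ^^ n) z))"
      using h by (intro Schwarz_Pick_fixpoint(1)[where h = ?H])
        (simp_all add: lin_frac_selfmap_def q selfmap_disk(2)[OF h])
    with Suc selfmap_disk(2)[OF h] show ?case by auto
  qed (simp add: z)
  have "1 - cnj q * w \<noteq> 0"
  proof
    assume "1 - cnj q * w = 0"
    then have "norm (cnj q * w) = 1" by simp
    then show False using q w by (simp add: norm_mult)
  qed
  then have "(\<lambda>n. ?M ((?H ^^ n) z)) \<longlonglongrightarrow> ?M w"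
    unfolding Moebius_function_simple by (intro tendsto_intros lim)
  then have "norm (?M w) \<le> norm (?M z)"
    by (intro LIMSEQ_le_const2[OF tendsto_norm]) (use orbit in auto)
  then show False
    using norm_Moebius_function_boundary[OF q(1) w] Moebius_function_norm_lt_1[OF q(1) z, of 0] by simp
qed

section \<open>The criterion at matching fixed points\<close>

text \<open>
  The algebraic core of the theorem. With \<open>\<phi>\<close>, \<open>\<psi>\<close> and \<open>f\<close> in normal form at \<open>p\<close>, \<open>q\<close> and \<open>p\<close>, with
  parameters \<open>(l, c)\<close>, \<open>(l', c')\<close> and \<open>(m, e)\<close>, commutation means \<open>l = l'\<close> and
  \<open>c + e l = e + c' m\<close>. If \<open>l \<noteq> 1\<close>, the second equation says that the second fixed points correspond. If
  \<open>l = 1\<close>, it reads \<open>c = c' m\<close>, which is the relation between the second derivatives; here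
  \<open>p\<close> is the only fixed point of \<open>\<phi>\<close>, and the equality of fixed point sets forces \<open>l' = 1\<close>.
\<close>

lemma commute_iff_at_fixpoints:
  assumes \<phi>: "lin_frac_selfmap \<phi>" "\<phi> \<noteq> id" and \<psi>: "lin_frac_selfmap \<psi>" "\<psi> \<noteq> id"
    and f: "lin_frac_selfmap f" and p: "norm p \<le> 1" "finite_part \<phi> p = p"
    and q: "norm q \<le> 1" "finite_part \<psi> q = q" and pq: "finite_part f p = q"
  shows "deriv (finite_part \<phi>) p \<noteq> 1 \<Longrightarrow>
      f \<circ> \<phi> = \<psi> \<circ> f \<longleftrightarrow>
      f ` Fix \<phi> = Fix \<psi> \<and> deriv (finite_part \<phi>) p = deriv (finite_part \<psi>) q"
    and "deriv (finite_part \<phi>) p = 1 \<Longrightarrow>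
      f \<circ> \<phi> = \<psi> \<circ> f \<longleftrightarrow>
      f ` Fix \<phi> = Fix \<psi> \<and>
      deriv (finite_part f) p * (deriv ^^ 2) (finite_part \<psi>) q = (deriv ^^ 2) (finite_part \<phi>) p"
proof -
  obtain l c where lc: "l \<noteq> 0" and \<phi>_eq: "\<phi> = moebius_at p p l c"
    using selfmap_normal_form[OF \<phi>(1) p] by blast
  obtain l' c' where l'c': "l' \<noteq> 0" and \<psi>_eq: "\<psi> = moebius_at q q l' c'"
    using selfmap_normal_form[OF \<psi>(1) q] by blast
  obtain m e where me: "m \<noteq> 0" and f_eq: "f = moebius_at p q m e"
    using selfmap_normal_form[OF f p(1) pq] by blast
  have comm: "f \<circ> \<phi> = \<psi> \<circ> f \<longleftrightarrow> l = l' \<and> c + e * l = e + c' * m"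
    unfolding \<phi>_eq \<psi>_eq f_eq by (rule commute_moebius_at_iff[OF lc me l'c'])
  have fp: "f (Some p) = Some q"
    by (simp add: f_eq moebius_at_Some)
  let ?r = "second_fixpoint p l c" and ?s = "second_fixpoint q l' c'"
  have Fix\<phi>: "Fix \<phi> = {Some p, ?r}" and Fix\<psi>: "Fix \<psi> = {Some q, ?s}"
    using Fix_moebius_at lc l'c' \<phi>(2) \<psi>(2) by (simp_all add: \<phi>_eq \<psi>_eq)
  have r: "?r = Some p \<longleftrightarrow> l = 1" and s: "?s = Some q \<longleftrightarrow> l' = 1"
    using second_fixpoint_eq_iff lc l'c' \<phi>(2) \<psi>(2) by (simp_all add: \<phi>_eq \<psi>_eq)
  have bij: "bij f" by (rule bij_selfmap[OF f])
  note Fix_image = image_Fix_of_commute[OF bij, of \<phi> \<psi>]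
  have derivs: "deriv (finite_part \<phi>) p = l" "deriv (finite_part \<psi>) q = l'"
    by (simp_all add: \<phi>_eq \<psi>_eq deriv_moebius_at)
  {
    assume "deriv (finite_part \<phi>) p \<noteq> 1"
    then have l1: "l \<noteq> 1" by (simp add: derivs)
    have "c + e * l = e + c' * m" if "f ` Fix \<phi> = Fix \<psi>" "l = l'"
    proof -
      \<comment> \<open>As \<open>f\<close> is injective and sends \<open>p\<close> to \<open>q\<close>, the other fixed point cannot be sent to \<open>q\<close>.\<close>
      have "f ?r \<noteq> Some q"
        using bij_is_inj[OF bij, THEN inj_eq, of ?r "Some p"] r l1 by (simp add: fp)
      then have "f ?r = ?s"
        using that(1) by (auto simp: Fix\<phi> Fix\<psi> fp)
      then show ?thesis
        using second_fixpoint_map_iff[OF l1 me] that(2) by (simp add: f_eq)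
    qed
    then show "f \<circ> \<phi> = \<psi> \<circ> f \<longleftrightarrow>
      f ` Fix \<phi> = Fix \<psi> \<and> deriv (finite_part \<phi>) p = deriv (finite_part \<psi>) q"
      using Fix_image comm unfolding derivs by blast
  next
    assume "deriv (finite_part \<phi>) p = 1"
    then have l1: "l = 1" by (simp add: derivs)
    have d2: "deriv (finite_part f) p * (deriv ^^ 2) (finite_part \<psi>) q = - 2 * l' * (c' * m)"
      "(deriv ^^ 2) (finite_part \<phi>) p = - 2 * c"
      by (simp_all only: \<phi>_eq \<psi>_eq f_eq deriv2_moebius_at deriv_moebius_at l1) simp_all
    have "l' = 1" if "f ` Fix \<phi> = Fix \<psi>"
      using that r s l1 by (simp add: Fix\<phi> Fix\<psi> fp)
    then show "f \<circ> \<phi> = \<psi> \<circ> f \<longleftrightarrow> f ` Fix \<phi> = Fix \<psi> \<and>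
      deriv (finite_part f) p * (deriv ^^ 2) (finite_part \<psi>) q = (deriv ^^ 2) (finite_part \<phi>) p"
      using Fix_image comm unfolding d2 by (auto simp: l1)
  }
qed

lemma Fix_parabolic_selfmap:
  assumes h: "lin_frac_selfmap h" "h \<noteq> id" and p: "norm p \<le> 1" "finite_part h p = p"
    and "deriv (finite_part h) p = 1"
  shows "Fix h = {Some p}"
proof -
  obtain l c where lc: "l \<noteq> 0" and h_eq: "h = moebius_at p p l c"
    using selfmap_normal_form[OF h(1) p] by blast
  then have "l = 1" using assms(5) by (simp add: deriv_moebius_at)
  then show ?thesis
    using Fix_moebius_at[of l p c] second_fixpoint_eq_iff[of l p c] lc h(2) by (simp add: h_eq)
qed

section \<open>Orbits and the Denjoy-Wolff point\<close>

lemma denjoy_wolff_orbit: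
  assumes "\<not> elliptic g" "denjoy_wolff_point g p" "norm z < 1"
  shows "(\<lambda>n. (g ^^ n) z) \<longlonglongrightarrow> p"
proof -
  have "\<forall>K. compact K \<and> K \<subseteq> unit_disk \<longrightarrow> uniform_limit K (\<lambda>n. g ^^ n) (\<lambda>_. p) sequentially"
    using assms by (simp add: denjoy_wolff_point_def)
  from this[rule_format, of "{z}"] have "uniform_limit {z} (\<lambda>n. g ^^ n) (\<lambda>_. p) sequentially"
    using assms by simp
  then show ?thesis
    by (rule tendsto_uniform_limitI) simp
qed

lemma denjoy_wolff_point_unique:
  assumes "\<not> elliptic g" "denjoy_wolff_point g p" "denjoy_wolff_point g p'"
  shows "p = p'"
  using denjoy_wolff_orbit[OF assms(1,2), of 0] denjoy_wolff_orbit[OF assms(1,3), of 0]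
  by (simp add: LIMSEQ_unique)

text \<open>
  In the non-elliptic case \<open>p\<close> is the limit of an orbit, and the map is continuous at the boundary point
  \<open>p\<close>.
\<close>

lemma denjoy_wolff_fixpoint:
  assumes h: "lin_frac_selfmap h" and p: "denjoy_wolff_point (finite_part h) p"
  shows "norm p \<le> 1" "finite_part h p = p"
proof -
  let ?H = "finite_part h"
  show le: "norm p \<le> 1"
    using p by (auto simp: denjoy_wolff_point_def split: if_splits)
  show "?H p = p"
  proof (cases "elliptic ?H")
    case True
    then show ?thesis using p by (simp add: denjoy_wolff_point_def)
  next
    case False
    then have lim: "(\<lambda>n. (?H ^^ n) 0) \<longlonglongrightarrow> p"
      using denjoy_wolff_orbit[OF _ p] by simp
    have "(\<lambda>n. ?H ((?H ^^ n) 0)) \<longlonglongrightarrow> ?H p"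
      by (rule isCont_tendsto_compose[OF isCont_finite_part_selfmap[OF h le] lim])
    moreover have "(\<lambda>n. ?H ((?H ^^ n) 0)) \<longlonglongrightarrow> p"
      using LIMSEQ_Suc[OF lim] by simp
    ultimately show ?thesis by (rule LIMSEQ_unique)
  qed
qed

text \<open>
  The orbit of 0 under \<open>\<phi>\<close> tends to \<open>p\<close>, so its image under \<open>f\<close>, which is an orbit of \<open>\<psi>\<close>, tends to
  \<open>f(p)\<close>. If \<open>\<psi>\<close> is not elliptic, this limit is \<open>q\<close>. If \<open>\<psi>\<close> is elliptic, its orbits do not tend to the
  circle, so \<open>f(p)\<close> is a fixed point in the disk, and there is only one.
\<close>

lemma commute_maps_denjoy_wolff:
  assumes \<phi>: "lin_frac_selfmap \<phi>" and \<psi>: "lin_frac_selfmap \<psi>" "\<psi> \<noteq> id"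
    and f: "lin_frac_selfmap f" and comm: "f \<circ> \<phi> = \<psi> \<circ> f"
    and ne: "\<not> elliptic (finite_part \<phi>)"
    and p: "denjoy_wolff_point (finite_part \<phi>) p" and q: "denjoy_wolff_point (finite_part \<psi>) q"
  shows "finite_part f p = q"
proof -
  let ?F = "finite_part f" and ?P = "finite_part \<phi>" and ?Q = "finite_part \<psi>"
  note p' = denjoy_wolff_fixpoint[OF \<phi> p]
  have step: "?F (?P z) = ?Q (?F z)" if "norm z \<le> 1" for z
  proof -
    have "f (Some (?P z)) = \<psi> (Some (?F z))"
      using comm[THEN fun_cong, of "Some z"] selfmap_cdisk(1)[OF \<phi> that] selfmap_cdisk(1)[OF f that]
      by simp
    then show ?thesis unfolding finite_part_def[of f "?P z"] finite_part_def[of \<psi> "?F z"] by simp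
  qed
  have orbit: "norm ((?P ^^ n) 0) < 1 \<and> ?F ((?P ^^ n) 0) = (?Q ^^ n) (?F 0)" for n
    by (induction n) (simp_all add: step selfmap_disk(2)[OF \<phi>])
  have "(\<lambda>n. ?F ((?P ^^ n) 0)) \<longlonglongrightarrow> ?F p"
    by (intro isCont_tendsto_compose[OF isCont_finite_part_selfmap[OF f p'(1)]]
        denjoy_wolff_orbit[OF ne p]) simp
  then have lim: "(\<lambda>n. (?Q ^^ n) (?F 0)) \<longlonglongrightarrow> ?F p"
    by (simp add: orbit)
  have F0: "norm (?F 0) < 1" by (simp add: selfmap_disk(2)[OF f])
  show ?thesis
  proof (cases "elliptic ?Q")
    case True
    then have q': "norm q < 1" "?Q q = q"
      using q by (auto simp: denjoy_wolff_point_def)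
    have "norm (?F p) \<noteq> 1"
      by (rule orbit_of_elliptic_not_to_boundary[OF \<psi>(1) q' F0 lim])
    then have "norm (?F p) < 1"
      using selfmap_cdisk(2)[OF f p'(1)] by simp
    moreover have "?Q (?F p) = ?F p"
      using step[OF p'(1)] p'(2) by simp
    ultimately show ?thesis
      by (rule selfmap_interior_fixpoint(2)[OF \<psi> q'])
  next
    case False
    then show ?thesis
      using LIMSEQ_unique[OF lim denjoy_wolff_orbit[OF False q F0]] by simp
  qed
qed

section \<open>Intertwining of linear fractional self-maps\<close>

theorem theorem7:
  fixes \<phi> \<psi> f :: "ext_complex \<Rightarrow> ext_complex" and p q :: complex
  assumes "lin_frac_selfmap \<phi>" and "lin_frac_selfmap \<psi>" and "lin_frac_selfmap f"
    and "\<phi> \<noteq> id" and "\<psi> \<noteq> id"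
    and "denjoy_wolff_point (finite_part \<phi>) p"
    and "denjoy_wolff_point (finite_part \<psi>) q"
  shows "(elliptic (finite_part \<phi>) \<longrightarrow>
            (intertwines f \<phi> \<psi> \<longleftrightarrow>
               f ` Fix \<phi> = Fix \<psi> \<and>
               deriv (finite_part \<phi>) p = deriv (finite_part \<psi>) q)) \<and>
         (hyperbolic (finite_part \<phi>) \<longrightarrow>
            (intertwines f \<phi> \<psi> \<longleftrightarrow>
               f ` Fix \<phi> = Fix \<psi> \<and> f (Some p) = Some q \<and>
               deriv (finite_part \<phi>) p = deriv (finite_part \<psi>) q)) \<and>
         (parabolic (finite_part \<phi>) \<longrightarrow>
            (intertwines f \<phi> \<psi> \<longleftrightarrow>
               f ` Fix \<phi> = Fix \<psi> \<and>
               deriv (finite_part f) p * (deriv ^^ 2) (finite_part \<psi>) q =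
                 (deriv ^^ 2) (finite_part \<phi>) p))"
proof -
  note \<phi> = assms(1) and \<psi> = assms(2) and f = assms(3)
  note p = denjoy_wolff_fixpoint[OF \<phi> assms(6)] and q = denjoy_wolff_fixpoint[OF \<psi> assms(7)]
  note criteria = commute_iff_at_fixpoints[OF \<phi> assms(4) \<psi> assms(5) f p q]
  note comm = intertwines_iff_commute[OF \<phi> \<psi> f]
  have bij: "bij f"
    by (rule bij_selfmap[OF f])
  have Fix_image: "f \<circ> \<phi> = \<psi> \<circ> f \<longrightarrow> f ` Fix \<phi> = Fix \<psi>"
    by (intro impI image_Fix_of_commute[OF bij])
  have fp: "f (Some p) = Some (finite_part f p)"
    by (rule selfmap_cdisk(1)[OF f p(1)])
  have "Some p \<in> Fix \<phi>" and q_Fix: "Some q \<in> Fix \<psi>"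
    using selfmap_cdisk(1)[OF \<phi> p(1)] selfmap_cdisk(1)[OF \<psi> q(1)] p(2) q(2)
    by (simp_all add: Fix_def)
  then have fp_Fix: "Some (finite_part f p) \<in> Fix \<psi>" if "f ` Fix \<phi> = Fix \<psi>"
    using that fp by (metis image_eqI)
  show ?thesis
  proof (intro conjI impI)
    assume "elliptic (finite_part \<phi>)"
    then have p1: "norm p < 1"
      using assms(6) by (simp add: denjoy_wolff_point_def)
    \<comment> \<open>The point \<open>f(p)\<close> is a fixed point of \<open>\<psi>\<close> in the disk, and \<open>\<psi>\<close> has only one.\<close>
    have "finite_part f p = q" if "f ` Fix \<phi> = Fix \<psi>"
    proof -
      have fixed: "finite_part \<psi> (finite_part f p) = finite_part f p"
        using fp_Fix[OF that] by (simp add: Fix_def finite_part_def[of \<psi>])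
      moreover have F1: "norm (finite_part f p) < 1"
        by (rule selfmap_disk(2)[OF f p1])
      ultimately have "elliptic (finite_part \<psi>)"
        by (auto simp: elliptic_def)
      then have "norm q < 1"
        using assms(7) by (simp add: denjoy_wolff_point_def)
      then show ?thesis
        by (rule selfmap_interior_fixpoint(2)[OF \<psi> assms(5) _ q(2) F1 fixed])
    qed
    then show "intertwines f \<phi> \<psi> \<longleftrightarrow> f ` Fix \<phi> = Fix \<psi> \<and>
        deriv (finite_part \<phi>) p = deriv (finite_part \<psi>) q"
      using criteria(1)[OF _ selfmap_interior_fixpoint(1)[OF \<phi> assms(4) p1 p(2)]] Fix_image
      unfolding comm by metis
  next
    assume "hyperbolic (finite_part \<phi>)"
    then obtain p' where ne: "\<not> elliptic (finite_part \<phi>)"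
      and p': "denjoy_wolff_point (finite_part \<phi>) p'" "deriv (finite_part \<phi>) p' < 1"
      unfolding hyperbolic_def by blast
    then have d: "deriv (finite_part \<phi>) p \<noteq> 1"
      using denjoy_wolff_point_unique[OF ne assms(6) p'(1)] by auto
    have "f \<circ> \<phi> = \<psi> \<circ> f \<Longrightarrow> finite_part f p = q"
      using commute_maps_denjoy_wolff[OF \<phi> \<psi> assms(5) f _ ne assms(6,7)] .
    then show "intertwines f \<phi> \<psi> \<longleftrightarrow> f ` Fix \<phi> = Fix \<psi> \<and> f (Some p) = Some q \<and>
        deriv (finite_part \<phi>) p = deriv (finite_part \<psi>) q"
      using criteria(1)[OF _ d] unfolding comm fp option.inject by metis
  next
    assume "parabolic (finite_part \<phi>)"
    then obtain p' where ne: "\<not> elliptic (finite_part \<phi>)"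
      and p': "denjoy_wolff_point (finite_part \<phi>) p'" "deriv (finite_part \<phi>) p' = 1"
      unfolding parabolic_def by blast
    then have d: "deriv (finite_part \<phi>) p = 1"
      using denjoy_wolff_point_unique[OF ne assms(6) p'(1)] by simp
    have "finite_part f p = q" if "f ` Fix \<phi> = Fix \<psi>"
    proof -
      have "Fix \<psi> = {Some (finite_part f p)}"
        unfolding that[symmetric] Fix_parabolic_selfmap[OF \<phi> assms(4) p d] using fp by simp
      with q_Fix show ?thesis by simp
    qed
    then show "intertwines f \<phi> \<psi> \<longleftrightarrow> f ` Fix \<phi> = Fix \<psi> \<and>
        deriv (finite_part f) p * (deriv ^^ 2) (finite_part \<psi>) q = (deriv ^^ 2) (finite_part \<phi>) p"
      unfolding comm using criteria(2)[OF _ d] Fix_image by metis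
  qed
qed

end
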